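(* Let $n\ge 1$ and let $A=(a_{i,j})_{i,j\in[n]}$ be an $n\times n$ matrix (with entries regarded as commuting variables). Then the Hamiltonian cycle polynomial satisfies $$P_{HC_n}(A)=\sum_{S\subseteq [n-1]}\det(-A_S)\,\operatorname{per}(A_{[n]\setminus S}).$$
   Context: Notation: $[n]=\{1,2,\dots,n\}$ (so $[0]=\varnothing$), and $\mathrm{S}_n$ is the group of permutations of $[n]$. The Hamiltonian cycle polynomial of an $n\times n$ matrix $A$ is $$P_{HC_n}(A)=\sum_{\sigma\in HC_n}\prod_{i\in[n]}a_{i,\sigma(i)},$$ where $HC_n$ is the set of permutations of $[n]$ containing exactly one cycle (fixed points count as cycles, so these are the permutations consisting of a single cycle of length $n$). The determinant and permanent are $\det(A)=\sum_{\sigma\in \mathrm{S}_n}\operatorname{sgn}(\sigma)\prod_{i\in[n]}a_{i,\sigma(i)}$ and $\operatorname{per}(A)=\sum_{\sigma\in \mathrm{S}_n}\prod_{i\in[n]}a_{i,\sigma(i)}$. For $S\subseteq[n]$, $A_S$ denotes the principal submatrix of $A$ with rows and columns indexed by $S$, and $\det(A_\varnothing):=1$ (hence also $\det(-A_\varnothing)=1$). *)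

theory Defs
  imports
    "Jordan_Normal_Form.Determinant"
    "Jordan_Normal_Form.DL_Submatrix"
    "HOL-Combinatorics.Orbits"
begin

text \<open>
  Matrices of type \<^typ>\<open>'a mat\<close> have their rows and columns indexed from 0, so the index set
  $[n] = \{1, \dots, n\}$ becomes \<^term>\<open>{0..<n::nat}\<close>, and $[n-1]$ becomes
  \<^term>\<open>{0..<n - 1 :: nat}\<close>.
\<close>

text \<open>
  The cycles of a permutation of \<open>{0..<n}\<close> are represented by their underlying sets, the orbits;
  a fixed point contributes a singleton orbit.
\<close>

definition cycles_of :: "nat \<Rightarrow> (nat \<Rightarrow> nat) \<Rightarrow> nat set set" where
  "cycles_of n \<sigma> = orbit \<sigma> ` {0..<n}"

definition HC :: "nat \<Rightarrow> (nat \<Rightarrow> nat) set" where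
  "HC n = {\<sigma>. \<sigma> permutes {0..<n} \<and> card (cycles_of n \<sigma>) = 1}"

definition hamiltonian_cycle_poly :: "'a :: comm_ring_1 mat \<Rightarrow> 'a" where
  "hamiltonian_cycle_poly A = (\<Sum>\<sigma> \<in> HC (dim_row A). \<Prod>i = 0..<dim_row A. A $$ (i, \<sigma> i))"

text \<open>Intended for square matrices only, like the Hamiltonian cycle polynomial above.\<close>

definition permanent :: "'a :: comm_ring_1 mat \<Rightarrow> 'a" where
  "permanent A =
     (\<Sum>\<sigma> | \<sigma> permutes {0..<dim_row A}. \<Prod>i = 0..<dim_row A. A $$ (i, \<sigma> i))"

definition principal_submatrix :: "'a mat \<Rightarrow> nat set \<Rightarrow> 'a mat" where
  "principal_submatrix A S = submatrix A S S"

end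

theory Submission
  imports Defs "HOL-Combinatorics.Cycles"
begin

text \<open>
  A product \<open>det (- A\<^sub>S) * per (A\<^sub>T)\<close>, where \<open>T\<close> is the complement of \<open>S\<close>, runs over pairs of a
  permutation of \<open>S\<close> and one of \<open>T\<close>. Gluing each pair turns it into a sum over the permutations
  \<open>\<sigma>\<close> of \<open>[n]\<close> that map \<open>S\<close> onto itself, with the usual monomial of \<open>\<sigma>\<close> and the weight
  \<open>(-1)^|S| * sgn (\<sigma>|\<^sub>S)\<close> (\<open>det_times_permanent\<close>). A cycle of length \<open>k\<close> has sign \<open>(-1)^(k-1)\<close>,
  so each cycle contributes \<open>-1\<close> to the weight, and the weight is \<open>(-1)^c\<close>, where \<open>c\<close> is the
  number of cycles of \<open>\<sigma>\<close> that make up \<open>S\<close>.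

  Exchanging the sums, the coefficient of the monomial of \<open>\<sigma>\<close> is the sum of these weights over the
  invariant sets \<open>S\<close> that avoid a chosen point \<open>a\<close>, i.e. over all choices of cycles of \<open>\<sigma>\<close> other
  than the one through \<open>a\<close>. If there is no other cycle, only the empty choice is left, with
  weight \<open>1\<close>. Otherwise fix one other cycle \<open>C\<close>: inserting it into or removing it from the choice
  flips the sign, so everything cancels (\<open>sum_signed_weight\<close>). What survives is the sum over the
  permutations with a single cycle.
\<close>

section \<open>Signed invariant sets\<close>

definition signed_weight :: "('a \<Rightarrow> 'a) \<Rightarrow> 'a set \<Rightarrow> int" where
  "signed_weight \<sigma> S = (-1) ^ card S * sign (perm_restrict \<sigma> S)"

lemma signed_weight_empty [simp]: "signed_weight \<sigma> {} = 1"
proof -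
  have "perm_restrict \<sigma> {} = id" by (auto simp: perm_restrict_def)
  then show ?thesis by (simp add: signed_weight_def)
qed

lemma perm_restrict_permutes:
  assumes "inj \<sigma>" "\<sigma> ` S = S"
  shows "perm_restrict \<sigma> S permutes S"
proof (rule bij_imp_permutes)
  have "bij_betw \<sigma> S S" using assms by (auto simp: bij_betw_def inj_on_def)
  then show "bij_betw (perm_restrict \<sigma> S) S S"
    by (subst bij_betw_cong[of S _ \<sigma>]) (auto simp: perm_restrict_def)
qed (simp add: perm_restrict_def)

text \<open>
  Multiplicativity, together with the value \<open>-1\<close> on a single orbit below, identifies the weight of
  an invariant set as \<open>-1\<close> to the number of its orbits, although orbits are never counted.
\<close>

lemma signed_weight_Un:
  assumes "inj \<sigma>" "finite S" "finite T" "S \<inter> T = {}" "\<sigma> ` S = S" "\<sigma> ` T = T"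
  shows "signed_weight \<sigma> (S \<union> T) = signed_weight \<sigma> S * signed_weight \<sigma> T"
proof -
  have S: "perm_restrict \<sigma> S permutes S" and T: "perm_restrict \<sigma> T permutes T"
    using assms by (auto intro: perm_restrict_permutes)
  have "perm_restrict \<sigma> (S \<union> T) = perm_restrict \<sigma> S \<circ> perm_restrict \<sigma> T"
    using perm_restrict_union[OF S T] assms by simp
  moreover have "permutation (perm_restrict \<sigma> S)" "permutation (perm_restrict \<sigma> T)"
    using S T assms permutation_permutes by blast+
  ultimately show ?thesis
    using assms by (simp add: signed_weight_def sign_compose card_Un_disjoint power_add)
qed

lemma sign_cycle_of_list:
  assumes "distinct cs"
  shows "sign (cycle_of_list cs) = (-1) ^ (length cs - 1)"
  using assms
proof (induction cs rule: cycle_of_list.induct)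
  case (1 i j cs)
  then have "i \<noteq> j" by auto
  have "sign (transpose i j \<circ> cycle_of_list (j # cs))
      = sign (transpose i j) * sign (cycle_of_list (j # cs))"
    by (intro sign_compose permutation_swap_id permutation_of_cycle)
  then show ?case using 1 \<open>i \<noteq> j\<close> by (simp add: sign_swap_id del: o_apply)
qed simp_all

lemma signed_weight_orbit:
  assumes "permutation \<sigma>"
  shows "signed_weight \<sigma> (orbit \<sigma> x) = -1"
proof -
  let ?cs = "support \<sigma> x"
  have set: "set ?cs = orbit \<sigma> x"
    unfolding support_set[OF assms] orbit_altdef_permutation[OF assms] by auto
  have dist: "distinct ?cs" by (rule cycle_of_permutation[OF assms])
  have "perm_restrict \<sigma> (orbit \<sigma> x) = cycle_of_list ?cs"
  proof
    fix b
    show "perm_restrict \<sigma> (orbit \<sigma> x) b = cycle_of_list ?cs b"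
    proof (cases "b \<in> orbit \<sigma> x")
      case True
      then show ?thesis using cycle_restrict[OF assms, of b x] set
        by (simp add: perm_restrict_def)
    next
      case False
      then show ?thesis using id_outside_supp[of b ?cs] set
        by (simp add: perm_restrict_def)
    qed
  qed
  moreover have "card (orbit \<sigma> x) = length ?cs"
    using distinct_card[OF dist] set by simp
  moreover have "length ?cs > 0"
    using least_power_of_permutation(2)[OF assms] by simp
  ultimately show ?thesis
    using sign_cycle_of_list[OF dist] unfolding signed_weight_def
    by (simp del: length_map length_upt flip: power_Suc power_add mult_2)
qed

lemma orbit_subset_invariant:
  assumes "\<sigma> ` S = S" "x \<in> S"
  shows "orbit \<sigma> x \<subseteq> S"
proof
  fix y assume "y \<in> orbit \<sigma> x"
  then show "y \<in> S" by induct (use assms in auto)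
qed

lemma image_orbit:
  assumes "permutation \<sigma>"
  shows "\<sigma> ` orbit \<sigma> x = orbit \<sigma> x"
proof -
  have "\<sigma> ` orbit \<sigma> x = orbit \<sigma> (\<sigma> x)"
    by (rule orbit_inverse) (use assms in \<open>auto intro: permutation_self_in_orbit\<close>)
  then show ?thesis using permutation_orbit_step[OF assms] by simp
qed

text \<open>
  This is the binomial expansion of \<open>(1 - 1)^m\<close>, where \<open>m\<close> is the number of orbits missing \<open>a\<close>.
  Isolating one such orbit \<open>C\<close> amounts to splitting off a single factor \<open>1 - 1\<close>.
\<close>

lemma sum_signed_weight:
  assumes \<sigma>: "\<sigma> permutes U" and U: "finite U" and a: "a \<in> U"
  shows "(\<Sum>S | S \<subseteq> U - {a} \<and> \<sigma> ` S = S. signed_weight \<sigma> S)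
       = (if orbit \<sigma> a = U then 1 else 0)"
proof -
  have perm: "permutation \<sigma>" using \<sigma> U permutation_permutes by blast
  have inj: "inj \<sigma>" using \<sigma> by (rule permutes_inj)
  have orbit_eq: "orbit \<sigma> y = orbit \<sigma> x" if "y \<in> orbit \<sigma> x" for x y
    using orbit_cyclic_eq3[OF cyclic_on_orbit'[OF perm] that] .
  show ?thesis
  proof (cases "orbit \<sigma> a = U")
    case True
    have "{S. S \<subseteq> U - {a} \<and> \<sigma> ` S = S} = {{}}"
    proof (intro equalityI subsetI)
      fix S assume S: "S \<in> {S. S \<subseteq> U - {a} \<and> \<sigma> ` S = S}"
      have "x \<notin> S" for x
      proof
        assume x: "x \<in> S"
        then have "orbit \<sigma> x \<subseteq> S" using S by (intro orbit_subset_invariant) auto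
        moreover have "orbit \<sigma> x = U" using x S True orbit_eq[of x a] by auto
        ultimately show False using S a by blast
      qed
      then show "S \<in> {{}}" by blast
    qed auto
    then show ?thesis using True by simp
  next
    case False
    have "orbit \<sigma> a \<subseteq> U" using \<sigma> a by (rule permutes_orbit_subset)
    then obtain x where x: "x \<in> U" "x \<notin> orbit \<sigma> a" using False by blast
    define C where "C = orbit \<sigma> x"
    have CU: "C \<subseteq> U" unfolding C_def using \<sigma> x(1) by (rule permutes_orbit_subset)
    have xC: "x \<in> C" unfolding C_def using perm by (rule permutation_self_in_orbit)
    have aC: "a \<notin> C"
      using orbit_eq[of a x] xC x(2) unfolding C_def by blast
    have fC: "\<sigma> ` C = C" unfolding C_def using perm by (rule image_orbit)
    have C_sub: "C \<subseteq> S" if "\<sigma> ` S = S" "S \<inter> C \<noteq> {}" for S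
    proof -
      obtain y where y: "y \<in> S" "y \<in> C" using \<open>S \<inter> C \<noteq> {}\<close> by blast
      then have "orbit \<sigma> y = C" using orbit_eq unfolding C_def by blast
      then show ?thesis using orbit_subset_invariant[OF that(1) y(1)] by simp
    qed
    \<comment> \<open>The choices of orbits without \<open>C\<close>; adding \<open>C\<close> to each of them gives all the others.\<close>
    define I where "I = {S. S \<subseteq> U - {a} \<and> \<sigma> ` S = S \<and> S \<inter> C = {}}"
    have finI: "finite I" unfolding I_def by (rule finite_subset[of _ "Pow U"]) (use U in auto)
    have I: "{S. S \<subseteq> U - {a} \<and> \<sigma> ` S = S} = I \<union> (\<lambda>S. S \<union> C) ` I"
    proof (intro equalityI subsetI)
      fix S assume S: "S \<in> {S. S \<subseteq> U - {a} \<and> \<sigma> ` S = S}"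
      show "S \<in> I \<union> (\<lambda>S. S \<union> C) ` I"
      proof (cases "S \<inter> C = {}")
        case True
        then show ?thesis using S by (auto simp: I_def)
      next
        case False
        have "C \<subseteq> S" using C_sub S False by auto
        moreover have "\<sigma> ` (S - C) = S - C" using S fC by (simp add: image_set_diff[OF inj])
        ultimately have "S - C \<in> I" "S = (S - C) \<union> C" using S by (auto simp: I_def)
        then show ?thesis by blast
      qed
    next
      fix S assume "S \<in> I \<union> (\<lambda>S. S \<union> C) ` I"
      then show "S \<in> {S. S \<subseteq> U - {a} \<and> \<sigma> ` S = S}"
        using CU aC fC by (auto simp: I_def image_Un)
    qed
    have disj: "I \<inter> (\<lambda>S. S \<union> C) ` I = {}" using xC by (auto simp: I_def)
    have "inj_on (\<lambda>S. S \<union> C) I" by (rule inj_onI) (auto simp: I_def)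
    then have "sum (signed_weight \<sigma>) ((\<lambda>S. S \<union> C) ` I) = (\<Sum>S\<in>I. signed_weight \<sigma> (S \<union> C))"
      by (simp add: sum.reindex)
    also have "\<dots> = (\<Sum>S\<in>I. - signed_weight \<sigma> S)"
    proof (rule sum.cong[OF refl])
      fix S assume "S \<in> I"
      then have "finite S" "finite C" "S \<inter> C = {}" "\<sigma> ` S = S"
        using U CU by (auto simp: I_def intro: finite_subset)
      then show "signed_weight \<sigma> (S \<union> C) = - signed_weight \<sigma> S"
        using signed_weight_Un[OF inj, of S C] fC signed_weight_orbit[OF perm, of x]
        by (simp add: C_def)
    qed
    finally show ?thesis
      unfolding I using False by (simp add: sum.union_disjoint[OF finI _ disj] finI sum_negf)
  qed
qed

text \<open>
  Counting orbits is replaced by a condition on the orbit of one point, the form in which the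
  cancellation lemma detects Hamiltonian cycles.
\<close>

lemma mem_HC_iff:
  assumes "a < n"
  shows "\<sigma> \<in> HC n \<longleftrightarrow> \<sigma> permutes {0..<n} \<and> orbit \<sigma> a = {0..<n}"
proof (cases "\<sigma> permutes {0..<n}")
  case True
  have perm: "permutation \<sigma>" using True permutation_permutes by blast
  have "card (orbit \<sigma> ` {0..<n}) = 1 \<longleftrightarrow> orbit \<sigma> a = {0..<n}"
  proof
    assume "card (orbit \<sigma> ` {0..<n}) = 1"
    then obtain C where "orbit \<sigma> ` {0..<n} = {C}" by (auto simp: card_1_singleton_iff)
    then have eq: "orbit \<sigma> x = orbit \<sigma> a" if "x < n" for x
      using that assms by (metis atLeastLessThan_iff imageI singletonD zero_le)
    have "x \<in> orbit \<sigma> a" if "x < n" for x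
      using eq[OF that] permutation_self_in_orbit[OF perm, of x] by simp
    then show "orbit \<sigma> a = {0..<n}"
      using permutes_orbit_subset[OF True, of a] assms by auto
  next
    assume eq: "orbit \<sigma> a = {0..<n}"
    have "orbit \<sigma> x = {0..<n}" if "x < n" for x
      using orbit_cyclic_eq3[OF cyclic_on_orbit'[OF perm, of a], of x] that eq by simp
    then have "orbit \<sigma> ` {0..<n} = {{0..<n}}" using assms by auto
    then show "card (orbit \<sigma> ` {0..<n}) = 1" by simp
  qed
  then show ?thesis using True by (simp add: HC_def cycles_of_def)
qed (simp add: HC_def)

section \<open>Determinants and permanents of principal submatrices\<close>

lemma bij_betw_map_permutation:
  assumes "bij_betw f A B"
  shows "bij_betw (map_permutation A f) {p. p permutes A} {p. p permutes B}"
proof -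
  have "map_permutation A f = (\<lambda>p x. if x \<in> B then f (p (inv_into A f x)) else x)"
    using assms by (auto simp: map_permutation_def restrict_id_def bij_betw_def fun_eq_iff)
  then show ?thesis using bij_betw_permutations[OF assms] by simp
qed

lemma bij_betw_pick:
  assumes "finite S"
  shows "bij_betw (pick S) {0..<card S} S"
proof -
  have inj: "inj_on (pick S) {0..<card S}"
    by (rule inj_onI) (metis atLeastLessThan_iff linorder_neqE_nat nat_less_le pick_mono_le)
  moreover have sub: "pick S ` {0..<card S} \<subseteq> S" using pick_in_set_le by auto
  moreover have "pick S ` {0..<card S} = S"
    by (rule card_subset_eq[OF assms sub]) (simp add: card_image[OF inj])
  ultimately show ?thesis by (simp add: bij_betw_def)
qed

text \<open>
  The rows of a principal submatrix are renumbered from 0; transporting permutations along the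
  renumbering \<open>pick S\<close> preserves their sign and hence lets both the determinant and the permanent
  be expanded over permutations of \<open>S\<close> itself. The function \<open>c\<close> is there to treat both at once.
\<close>

lemma sum_permutes_principal_submatrix:
  fixes A :: "'a :: comm_ring_1 mat" and c :: "int \<Rightarrow> 'a"
  assumes A: "A \<in> carrier_mat n n" and S: "S \<subseteq> {0..<n}"
  shows "(\<Sum>p | p permutes {0..<card S}.
            c (sign p) * (\<Prod>i = 0..<card S. principal_submatrix A S $$ (i, p i)))
       = (\<Sum>p | p permutes S. c (sign p) * (\<Prod>i\<in>S. A $$ (i, p i)))"
proof -
  let ?K = "{0..<card S}"
  have fin: "finite S" using S finite_subset by blast
  note bij = bij_betw_pick[OF fin]
  have dims: "{i. i < dim_row A \<and> i \<in> S} = S" "{i. i < dim_col A \<and> i \<in> S} = S"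
    using A S by auto
  have "c (sign p) * (\<Prod>i\<in>?K. principal_submatrix A S $$ (i, p i))
      = c (sign (map_permutation ?K (pick S) p))
        * (\<Prod>i\<in>S. A $$ (i, map_permutation ?K (pick S) p i))" if p: "p permutes ?K" for p
  proof -
    have "(\<Prod>i\<in>S. A $$ (i, map_permutation ?K (pick S) p i))
        = (\<Prod>i\<in>?K. A $$ (pick S i, map_permutation ?K (pick S) p (pick S i)))"
      by (rule prod.reindex_bij_betw[OF bij, symmetric])
    also have "\<dots> = (\<Prod>i\<in>?K. principal_submatrix A S $$ (i, p i))"
    proof (rule prod.cong[OF refl])
      fix i assume i: "i \<in> ?K"
      have "p i \<in> ?K" using p i by (simp only: permutes_in_image)
      then show "A $$ (pick S i, map_permutation ?K (pick S) p (pick S i))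
          = principal_submatrix A S $$ (i, p i)"
        using i map_permutation_apply[OF bij_betw_imp_inj_on[OF bij] i]
          submatrix_index[of i A S "p i" S]
        by (simp add: principal_submatrix_def dims)
    qed
    finally show ?thesis
      using sign_map_permutation[OF bij_betw_imp_inj_on[OF bij] p] by simp
  qed
  then have "(\<Sum>p | p permutes ?K. c (sign p) * (\<Prod>i\<in>?K. principal_submatrix A S $$ (i, p i)))
    = (\<Sum>p | p permutes ?K. c (sign (map_permutation ?K (pick S) p))
        * (\<Prod>i\<in>S. A $$ (i, map_permutation ?K (pick S) p i)))"
    by (intro sum.cong) auto
  also have "\<dots> = (\<Sum>p | p permutes S. c (sign p) * (\<Prod>i\<in>S. A $$ (i, p i)))"
    by (rule sum.reindex_bij_betw[OF bij_betw_map_permutation[OF bij]])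
  finally show ?thesis .
qed

lemma principal_submatrix_carrier:
  assumes "A \<in> carrier_mat n n" "S \<subseteq> {0..<n}"
  shows "principal_submatrix A S \<in> carrier_mat (card S) (card S)"
proof -
  have "{i. i < n \<and> i \<in> S} = S" using assms by auto
  then show ?thesis using assms by (auto simp: principal_submatrix_def dim_submatrix)
qed

lemma permanent_principal_submatrix:
  fixes A :: "'a :: comm_ring_1 mat"
  assumes "A \<in> carrier_mat n n" "S \<subseteq> {0..<n}"
  shows "permanent (principal_submatrix A S) = (\<Sum>p | p permutes S. \<Prod>i\<in>S. A $$ (i, p i))"
  using sum_permutes_principal_submatrix[OF assms, of "\<lambda>_. 1"] principal_submatrix_carrier[OF assms]
  by (simp add: permanent_def)

text \<open>
  The factor \<open>(-1) ^ card S\<close> in the weight is the one that negating the matrix pulls out of the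
  determinant.
\<close>

lemma det_uminus_principal_submatrix:
  fixes A :: "'a :: comm_ring_1 mat"
  assumes "A \<in> carrier_mat n n" "S \<subseteq> {0..<n}"
  shows "det (- principal_submatrix A S)
       = (\<Sum>p | p permutes S. of_int (signed_weight p S) * (\<Prod>i\<in>S. A $$ (i, p i)))"
proof -
  let ?B = "principal_submatrix A S" and ?K = "{0..<card S}"
  have B: "?B \<in> carrier_mat (card S) (card S)" using principal_submatrix_carrier[OF assms] .
  have "det (- ?B) = (\<Sum>p | p permutes ?K. of_int (sign p) * (\<Prod>i\<in>?K. (- ?B) $$ (i, p i)))"
    using B by (intro det_def') auto
  also have "\<dots> = (\<Sum>p | p permutes ?K.
      ((-1) ^ card S * of_int (sign p)) * (\<Prod>i\<in>?K. ?B $$ (i, p i)))"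
  proof (rule sum.cong[OF refl])
    fix p assume "p \<in> {p. p permutes ?K}"
    then have p: "p i \<in> ?K" if "i \<in> ?K" for i using that by (simp only: mem_Collect_eq permutes_in_image)
    have "(\<Prod>i\<in>?K. (- ?B) $$ (i, p i)) = (\<Prod>i\<in>?K. - ?B $$ (i, p i))"
      by (rule prod.cong[OF refl]) (use p B in auto)
    then show "of_int (sign p) * (\<Prod>i\<in>?K. (- ?B) $$ (i, p i))
       = ((-1) ^ card S * of_int (sign p)) * (\<Prod>i\<in>?K. ?B $$ (i, p i))"
      by (simp add: prod_uminus)
  qed
  also have "\<dots> = (\<Sum>p | p permutes S.
      ((-1) ^ card S * of_int (sign p)) * (\<Prod>i\<in>S. A $$ (i, p i)))"
    by (rule sum_permutes_principal_submatrix[OF assms])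
  also have "\<dots> = (\<Sum>p | p permutes S. of_int (signed_weight p S) * (\<Prod>i\<in>S. A $$ (i, p i)))"
    by (rule sum.cong) (auto simp: signed_weight_def)
  finally show ?thesis .
qed

section \<open>Gluing permutations\<close>

lemma bij_betw_glue_permutations:
  assumes "S \<subseteq> U"
  shows "bij_betw (\<lambda>(p, q). p \<circ> q) ({p. p permutes S} \<times> {q. q permutes U - S})
           {\<sigma>. \<sigma> permutes U \<and> \<sigma> ` S = S}"
proof (rule bij_betw_byWitness[where f' = "\<lambda>\<sigma>. (perm_restrict \<sigma> S, perm_restrict \<sigma> (U - S))"])
  show "\<forall>(pq) \<in> {p. p permutes S} \<times> {q. q permutes U - S}.
    (perm_restrict ((\<lambda>(p, q). p \<circ> q) pq) S, perm_restrict ((\<lambda>(p, q). p \<circ> q) pq) (U - S)) = pq"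
  proof safe
    fix p q assume p: "p permutes S" and q: "q permutes U - S"
    show "perm_restrict (p \<circ> q) S = p"
      using p q by (auto simp: perm_restrict_def fun_eq_iff permutes_not_in)
    have "q x \<notin> S" if "x \<in> U - S" for x using permutes_in_image[OF q, of x] that by auto
    then show "perm_restrict (p \<circ> q) (U - S) = q"
      using permutes_not_in[OF p] permutes_not_in[OF q] 
      by (simp add: perm_restrict_def fun_eq_iff)
  qed
  show "\<forall>\<sigma> \<in> {\<sigma>. \<sigma> permutes U \<and> \<sigma> ` S = S}.
    (\<lambda>(p, q). p \<circ> q) (perm_restrict \<sigma> S, perm_restrict \<sigma> (U - S)) = \<sigma>"
  proof safe
    fix \<sigma> assume \<sigma>: "\<sigma> permutes U" and S: "\<sigma> ` S = S"
    have "\<sigma> ` (U - S) = U - S"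
      using S by (simp add: image_set_diff[OF permutes_inj[OF \<sigma>]] permutes_image[OF \<sigma>])
    then have "perm_restrict \<sigma> S \<circ> perm_restrict \<sigma> (U - S) = perm_restrict \<sigma> (S \<union> (U - S))"
      using S by (intro perm_restrict_union perm_restrict_permutes permutes_inj[OF \<sigma>]) auto
    then show "perm_restrict \<sigma> S \<circ> perm_restrict \<sigma> (U - S) = \<sigma>"
      using assms \<sigma> by (simp add: Un_absorb1)
  qed
  show "(\<lambda>(p, q). p \<circ> q) ` ({p. p permutes S} \<times> {q. q permutes U - S})
      \<subseteq> {\<sigma>. \<sigma> permutes U \<and> \<sigma> ` S = S}"
  proof safe
    fix p q assume p: "p permutes S" and q: "q permutes U - S"
    show "p \<circ> q permutes U"
      using p q assms by (intro permutes_compose) (auto intro: permutes_subset)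
    have "q ` S = S" using permutes_not_in[OF q] by force
    then have eq: "(p \<circ> q) ` S = S" using permutes_image[OF p] by (simp only: image_comp[symmetric])
    show "(p \<circ> q) x \<in> S" if "x \<in> S" for x using eq that by blast
    show "x \<in> (p \<circ> q) ` S" if "x \<in> S" for x using eq that by simp
  qed
  show "(\<lambda>\<sigma>. (perm_restrict \<sigma> S, perm_restrict \<sigma> (U - S))) ` {\<sigma>. \<sigma> permutes U \<and> \<sigma> ` S = S}
      \<subseteq> {p. p permutes S} \<times> {q. q permutes U - S}"
  proof (intro subsetI, elim imageE)
    fix z \<sigma> assume "\<sigma> \<in> {\<sigma>. \<sigma> permutes U \<and> \<sigma> ` S = S}"
      and z: "z = (perm_restrict \<sigma> S, perm_restrict \<sigma> (U - S))"
    then have \<sigma>: "\<sigma> permutes U" and S: "\<sigma> ` S = S" by auto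
    have "\<sigma> ` (U - S) = U - S"
      using S by (simp add: image_set_diff[OF permutes_inj[OF \<sigma>]] permutes_image[OF \<sigma>])
    then show "z \<in> {p. p permutes S} \<times> {q. q permutes U - S}"
      using S z by (auto intro: perm_restrict_permutes permutes_inj[OF \<sigma>])
  qed
qed

lemma det_times_permanent:
  fixes A :: "'a :: comm_ring_1 mat"
  assumes A: "A \<in> carrier_mat n n" and S: "S \<subseteq> {0..<n}"
  shows "det (- principal_submatrix A S) * permanent (principal_submatrix A ({0..<n} - S))
       = (\<Sum>\<sigma> | \<sigma> permutes {0..<n} \<and> \<sigma> ` S = S.
            of_int (signed_weight \<sigma> S) * (\<Prod>i = 0..<n. A $$ (i, \<sigma> i)))"
proof -
  let ?U = "{0..<n}"
  let ?g = "\<lambda>\<sigma>. of_int (signed_weight \<sigma> S) * (\<Prod>i\<in>?U. A $$ (i, \<sigma> i))"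
  have "det (- principal_submatrix A S) * permanent (principal_submatrix A (?U - S))
     = (\<Sum>(p, q) \<in> {p. p permutes S} \<times> {q. q permutes ?U - S}.
         (of_int (signed_weight p S) * (\<Prod>i\<in>S. A $$ (i, p i))) * (\<Prod>i\<in>?U - S. A $$ (i, q i)))"
    unfolding det_uminus_principal_submatrix[OF A S]
      permanent_principal_submatrix[OF A Diff_subset] sum_product sum.cartesian_product ..
  also have "\<dots> = (\<Sum>pq \<in> {p. p permutes S} \<times> {q. q permutes ?U - S}. ?g ((\<lambda>(p, q). p \<circ> q) pq))"
  proof (rule sum.cong[OF refl])
    fix pq assume "pq \<in> {p. p permutes S} \<times> {q. q permutes ?U - S}"
    then obtain p q where pq: "pq = (p, q)" and p: "p permutes S" and q: "q permutes ?U - S"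
      by auto
    have inS: "(p \<circ> q) i = p i" if "i \<in> S" for i using permutes_not_in[OF q] that by simp
    have "q i \<notin> S" if "i \<in> ?U - S" for i using permutes_in_image[OF q, of i] that by auto
    then have outS: "(p \<circ> q) i = q i" if "i \<in> ?U - S" for i using permutes_not_in[OF p] that by simp
    have "perm_restrict (p \<circ> q) S = perm_restrict p S"
      using inS by (auto simp: perm_restrict_def)
    then have w: "signed_weight (p \<circ> q) S = signed_weight p S" by (simp add: signed_weight_def)
    have "(\<Prod>i\<in>?U. A $$ (i, (p \<circ> q) i))
        = (\<Prod>i\<in>?U - S. A $$ (i, (p \<circ> q) i)) * (\<Prod>i\<in>S. A $$ (i, (p \<circ> q) i))"
      by (rule prod.subset_diff[OF S]) simp
    also have "\<dots> = (\<Prod>i\<in>?U - S. A $$ (i, q i)) * (\<Prod>i\<in>S. A $$ (i, p i))"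
      by (intro arg_cong2[of _ _ _ _ "(*)"] prod.cong refl) (simp_all only: inS outS)
    finally show "(case pq of (p, q) \<Rightarrow>
          of_int (signed_weight p S) * (\<Prod>i\<in>S. A $$ (i, p i)) * (\<Prod>i\<in>?U - S. A $$ (i, q i)))
        = ?g ((\<lambda>(p, q). p \<circ> q) pq)"
      using w by (simp add: pq ac_simps)
  qed
  also have "\<dots> = (\<Sum>\<sigma> | \<sigma> permutes ?U \<and> \<sigma> ` S = S. ?g \<sigma>)"
    by (rule sum.reindex_bij_betw[OF bij_betw_glue_permutations[OF S]])
  finally show ?thesis .
qed

section \<open>The Hamiltonian cycle polynomial\<close>

theorem mainTheorem1:
  fixes A :: "'a :: comm_ring_1 mat" and n :: nat
  assumes "n \<ge> 1" and "A \<in> carrier_mat n n"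
  shows "hamiltonian_cycle_poly A =
    (\<Sum>S \<in> Pow {0..<n - 1}.
       det (- principal_submatrix A S) * permanent (principal_submatrix A ({0..<n} - S)))"
proof -
  let ?U = "{0..<n}" and ?V = "{0..<n - 1}"
  let ?m = "\<lambda>\<sigma>. \<Prod>i\<in>?U. A $$ (i, \<sigma> i)"
  have V: "?V = ?U - {n - 1}" using assms(1) by auto
  have "(\<Sum>S \<in> Pow ?V. det (- principal_submatrix A S) * permanent (principal_submatrix A (?U - S)))
      = (\<Sum>S \<in> Pow ?V. \<Sum>\<sigma> | \<sigma> \<in> {\<sigma>. \<sigma> permutes ?U} \<and> \<sigma> ` S = S.
           of_int (signed_weight \<sigma> S) * ?m \<sigma>)"
  proof (rule sum.cong[OF refl])
    fix S assume "S \<in> Pow ?V"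
    then have "S \<subseteq> ?U" by auto
    from det_times_permanent[OF assms(2) this]
    show "det (- principal_submatrix A S) * permanent (principal_submatrix A (?U - S))
      = (\<Sum>\<sigma> | \<sigma> \<in> {\<sigma>. \<sigma> permutes ?U} \<and> \<sigma> ` S = S. of_int (signed_weight \<sigma> S) * ?m \<sigma>)"
      by simp
  qed
  also have "\<dots> = (\<Sum>\<sigma> | \<sigma> permutes ?U. \<Sum>S | S \<in> Pow ?V \<and> \<sigma> ` S = S.
           of_int (signed_weight \<sigma> S) * ?m \<sigma>)"
    by (rule sum.swap_restrict) (simp_all add: finite_permutations)
  also have "\<dots> = (\<Sum>\<sigma> | \<sigma> permutes ?U. if orbit \<sigma> (n - 1) = ?U then ?m \<sigma> else 0)"
  proof (rule sum.cong[OF refl])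
    fix \<sigma> assume "\<sigma> \<in> {\<sigma>. \<sigma> permutes ?U}"
    then have "(\<Sum>S | S \<in> Pow ?V \<and> \<sigma> ` S = S. signed_weight \<sigma> S)
        = (if orbit \<sigma> (n - 1) = ?U then 1 else 0)"
      using sum_signed_weight[of \<sigma> ?U "n - 1"] assms(1) unfolding V Pow_iff by simp
    then have "(\<Sum>S | S \<in> Pow ?V \<and> \<sigma> ` S = S. of_int (signed_weight \<sigma> S) :: 'a)
        = (if orbit \<sigma> (n - 1) = ?U then 1 else 0)"
      by (simp flip: of_int_sum)
    then show "(\<Sum>S | S \<in> Pow ?V \<and> \<sigma> ` S = S. of_int (signed_weight \<sigma> S) * ?m \<sigma>)
        = (if orbit \<sigma> (n - 1) = ?U then ?m \<sigma> else 0)"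
      by (simp flip: sum_distrib_right)
  qed
  also have "\<dots> = (\<Sum>\<sigma> | \<sigma> permutes ?U \<and> orbit \<sigma> (n - 1) = ?U. ?m \<sigma>)"
    by (simp add: finite_permutations flip: sum.inter_filter)
  also have "{\<sigma>. \<sigma> permutes ?U \<and> orbit \<sigma> (n - 1) = ?U} = HC n"
    using mem_HC_iff[of "n - 1" n] assms(1) by auto
  also have "(\<Sum>\<sigma>\<in>HC n. ?m \<sigma>) = hamiltonian_cycle_poly A"
    using assms(2) by (simp add: hamiltonian_cycle_poly_def)
  finally show ?thesis by simp
qed

end
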